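(* Let $l\ge 2$ be an integer and let $\mathcal{H}=(V,H)$ be the $l$-lattice hypergraph. The eigenvalues of its clique Laplacian $L_{\mathrm{cl}}$ are $$\lambda_0=0\ (\text{multiplicity }1),\qquad \lambda_1=l\ (\text{multiplicity }2(l-1)),\qquad \lambda_2=2l\ (\text{multiplicity }(l-1)^2).$$
   Context: The $l$-lattice hypergraph has $l^2$ vertices $(r,c)$, $r,c\in\{0,\dots,l-1\}$, arranged in an $l\times l$ grid, and exactly $2l$ hyperedges: the $l$ rows $\{(r,c):0\le c\le l-1\}$ and the $l$ columns $\{(r,c):0\le r\le l-1\}$. Clique adjacency matrix: $A_{\mathrm{cl}}(u,u)=0$, and for $u\neq v$, $A_{\mathrm{cl}}(u,v)$ is the number of hyperedges containing both $u$ and $v$; equivalently $A_{\mathrm{cl}}=(J_l-I_l)\otimes I_l+I_l\otimes(J_l-I_l)$, where $J_l$ is the $l\times l$ all-ones matrix and $I_l$ the identity. The clique Laplacian is $L_{\mathrm{cl}}=D_{\mathrm{cl}}-A_{\mathrm{cl}}=2(l-1)I_{l^2}-A_{\mathrm{cl}}$, where $D_{\mathrm{cl}}$ is the diagonal matrix of row sums of $A_{\mathrm{cl}}$. *)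

theory Defs
  imports "Jordan_Normal_Form.Char_Poly"
begin

definition lattice_vertices :: "nat \<Rightarrow> (nat \<times> nat) set" where
  "lattice_vertices l = {..<l} \<times> {..<l}"

definition lattice_row :: "nat \<Rightarrow> nat \<Rightarrow> (nat \<times> nat) set" where
  "lattice_row l r = {(r, c) | c. c < l}"

definition lattice_column :: "nat \<Rightarrow> nat \<Rightarrow> (nat \<times> nat) set" where
  "lattice_column l c = {(r, c) | r. r < l}"

definition lattice_hyperedges :: "nat \<Rightarrow> (nat \<times> nat) set set" where
  "lattice_hyperedges l = lattice_row l ` {..<l} \<union> lattice_column l ` {..<l}"

text \<open>Matrices are indexed by numbers, so the vertices are enumerated row by row; this is the
  ordering for which the clique adjacency matrix is
  \<open>(J - I) \<otimes> I + I \<otimes> (J - I)\<close>.\<close>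

definition lattice_vertex :: "nat \<Rightarrow> nat \<Rightarrow> nat \<times> nat" where
  "lattice_vertex l i = (i div l, i mod l)"

lemma bij_betw_lattice_vertex:
  "bij_betw (lattice_vertex l) {..<l\<^sup>2} (lattice_vertices l)"
proof (rule bij_betw_byWitness[where f' = "\<lambda>(r, c). r * l + c"])
  show "(\<lambda>(r, c). r * l + c) ` lattice_vertices l \<subseteq> {..<l\<^sup>2}"
  proof (clarsimp simp: lattice_vertices_def)
    fix r c assume "r < l" "c < l"
    then have "r * l + c < Suc r * l" by simp
    also have "\<dots> \<le> l * l" using \<open>r < l\<close> by (intro mult_right_mono) auto
    finally show "r * l + c < l\<^sup>2" by (simp add: power2_eq_square)
  qed
  show "lattice_vertex l ` {..<l\<^sup>2} \<subseteq> lattice_vertices l"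
    by (cases "l = 0")
      (auto simp: lattice_vertex_def lattice_vertices_def power2_eq_square less_mult_imp_div_less)
qed (auto simp: lattice_vertex_def lattice_vertices_def)

definition clique_adjacency :: "'v set set \<Rightarrow> 'v \<Rightarrow> 'v \<Rightarrow> nat" where
  "clique_adjacency H u v = (if u = v then 0 else card {e \<in> H. u \<in> e \<and> v \<in> e})"

definition clique_adjacency_mat :: "'v set set \<Rightarrow> nat \<Rightarrow> (nat \<Rightarrow> 'v) \<Rightarrow> real mat" where
  "clique_adjacency_mat H n v = mat n n (\<lambda>(i, j). real (clique_adjacency H (v i) (v j)))"

definition row_sum_mat :: "real mat \<Rightarrow> real mat" where
  "row_sum_mat A = mat (dim_row A) (dim_row A)
     (\<lambda>(i, j). if i = j then \<Sum>k<dim_col A. A $$ (i, k) else 0)"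

definition clique_laplacian_mat :: "'v set set \<Rightarrow> nat \<Rightarrow> (nat \<Rightarrow> 'v) \<Rightarrow> real mat" where
  "clique_laplacian_mat H n v =
     row_sum_mat (clique_adjacency_mat H n v) - clique_adjacency_mat H n v"

definition lattice_clique_laplacian :: "nat \<Rightarrow> real mat" where
  "lattice_clique_laplacian l =
     clique_laplacian_mat (lattice_hyperedges l) (l\<^sup>2) (lattice_vertex l)"

definition eigenvalue_multiplicity :: "real mat \<Rightarrow> real \<Rightarrow> nat" where
  "eigenvalue_multiplicity A k = order k (char_poly A)"

end

theory Submission
  imports Defs
begin

text \<open>
  The clique Laplacian is the Kronecker sum \<open>K \<otimes> I + I \<otimes> K\<close> with \<open>K = l I - J\<close>, the Laplacian
  of the complete graph on \<open>l\<close> vertices. Conjugating \<open>K\<close> by the basis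
  \<open>\<one>, e\<^sub>1 - e\<^sub>0, \<dots>, e\<^sub>l\<^sub>-\<^sub>1 - e\<^sub>0\<close> turns it into \<open>diag(0, l, \<dots>, l)\<close>, so the Kronecker square of this basis
  diagonalises the Laplacian, and the multiplicities count the pairs \<open>(i, j)\<close> according to how
  many of their entries vanish.
\<close>

section \<open>Kronecker products\<close>

text \<open>Splitting an index by \<open>div\<close> and \<open>mod\<close> is the enumeration used
  by \<open>lattice_vertex\<close>, so the two tensor factors act on the row and the column
  coordinate of a vertex without any reindexing.\<close>

definition kronecker_mat :: "'a :: times mat \<Rightarrow> 'a mat \<Rightarrow> 'a mat" where
  "kronecker_mat A B = mat (dim_row A * dim_row B) (dim_col A * dim_col B)
     (\<lambda>(i, j). A $$ (i div dim_row B, j div dim_col B) * B $$ (i mod dim_row B, j mod dim_col B))"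

lemma kronecker_mat_carrier [intro, simp]:
  assumes "A \<in> carrier_mat n m" "B \<in> carrier_mat p q"
  shows "kronecker_mat A B \<in> carrier_mat (n * p) (m * q)"
  using assms by (auto simp: kronecker_mat_def)

lemma index_kronecker_mat:
  assumes "A \<in> carrier_mat n m" "B \<in> carrier_mat p q" "i < n * p" "j < m * q"
  shows "kronecker_mat A B $$ (i, j) = A $$ (i div p, j div q) * B $$ (i mod p, j mod q)"
  using assms by (auto simp: kronecker_mat_def)

lemma div_mod_less_mult:
  fixes i n p :: nat
  assumes "i < n * p"
  shows "i div p < n" "i mod p < p"
proof -
  show "i div p < n" using assms by (simp add: less_mult_imp_div_less)
  show "i mod p < p" using assms by (cases "p = 0") auto
qed

text \<open>The map \<open>k \<mapsto> (k div p, k mod p)\<close> is a bijection onto the pairs.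
  Every sum over a Kronecker index is turned into a double sum this way.\<close>

lemma sum_lessThan_mult_div_mod:
  fixes f :: "nat \<Rightarrow> nat \<Rightarrow> 'a :: comm_monoid_add"
  shows "(\<Sum>k<n * p. f (k div p) (k mod p)) = (\<Sum>i<n. \<Sum>j<p. f i j)"
proof -
  have "(\<Sum>i<n. \<Sum>j<p. f i j) = (\<Sum>(i, j)\<in>{..<n} \<times> {..<p}. f i j)"
    by (simp add: sum.cartesian_product)
  also have "\<dots> = (\<Sum>k<n * p. f (k div p) (k mod p))"
  proof (rule sum.reindex_bij_witness[where i = "\<lambda>k. (k div p, k mod p)" and j = "\<lambda>(i, j). i * p + j"])
    fix a assume a: "a \<in> {..<n} \<times> {..<p}"
    then obtain i j where [simp]: "a = (i, j)" and ij: "i < n" "j < p" by auto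
    have "i * p + j < Suc i * p" using ij by simp
    also have "\<dots> \<le> n * p" using ij by (intro mult_right_mono) auto
    finally show "(case a of (i, j) \<Rightarrow> i * p + j) \<in> {..<n * p}" by simp
  qed (auto simp: div_mod_less_mult)
  finally show ?thesis ..
qed

text \<open>The mixed-product rule: the summation index splits into a pair, and the double sum of
  products factors into a product of two sums.\<close>

lemma kronecker_mat_mult:
  fixes A B C D :: "'a :: comm_semiring_1 mat"
  assumes A: "A \<in> carrier_mat n m" and B: "B \<in> carrier_mat m k"
    and C: "C \<in> carrier_mat p q" and D: "D \<in> carrier_mat q r"
  shows "kronecker_mat A C * kronecker_mat B D = kronecker_mat (A * B) (C * D)"
proof (rule eq_matI)
  have AB: "A * B \<in> carrier_mat n k" and CD: "C * D \<in> carrier_mat p r"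
    using A B C D by auto
  fix i j
  assume "i < dim_row (kronecker_mat (A * B) (C * D))" "j < dim_col (kronecker_mat (A * B) (C * D))"
  then have i: "i < n * p" and j: "j < k * r" using A B C D by (auto simp: kronecker_mat_def)
  note bounds = div_mod_less_mult[OF i] div_mod_less_mult[OF j]
  have "(kronecker_mat A C * kronecker_mat B D) $$ (i, j) =
      (\<Sum>s<m * q. kronecker_mat A C $$ (i, s) * kronecker_mat B D $$ (s, j))"
    using kronecker_mat_carrier[OF A C] kronecker_mat_carrier[OF B D] i j
    by (simp add: scalar_prod_def atLeast0LessThan)
  also have "\<dots> = (\<Sum>s<m * q. (A $$ (i div p, s div q) * B $$ (s div q, j div r)) *
      (C $$ (i mod p, s mod q) * D $$ (s mod q, j mod r)))"
    using i j by (intro sum.cong refl)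
      (simp add: index_kronecker_mat[OF A C] index_kronecker_mat[OF B D] ac_simps)
  also have "\<dots> = (\<Sum>s<m. \<Sum>t<q. (A $$ (i div p, s) * B $$ (s, j div r)) *
      (C $$ (i mod p, t) * D $$ (t, j mod r)))"
    by (rule sum_lessThan_mult_div_mod)
  also have "\<dots> = (A * B) $$ (i div p, j div r) * (C * D) $$ (i mod p, j mod r)"
    using A B C D bounds by (simp add: scalar_prod_def atLeast0LessThan sum_product)
  also have "\<dots> = kronecker_mat (A * B) (C * D) $$ (i, j)"
    using i j by (simp add: index_kronecker_mat[OF AB CD])
  finally show "(kronecker_mat A C * kronecker_mat B D) $$ (i, j) =
    kronecker_mat (A * B) (C * D) $$ (i, j)" .
qed (use A B C D in \<open>auto simp: kronecker_mat_def\<close>)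

lemma kronecker_mat_one:
  "kronecker_mat (1\<^sub>m n) (1\<^sub>m m) = (1\<^sub>m (n * m) :: 'a :: semiring_1 mat)"
proof (rule eq_matI)
  fix i j assume "i < dim_row (1\<^sub>m (n * m) :: 'a mat)" "j < dim_col (1\<^sub>m (n * m) :: 'a mat)"
  then have i: "i < n * m" and j: "j < n * m" by auto
  have "i = j \<longleftrightarrow> i div m = j div m \<and> i mod m = j mod m"
    by (metis div_mult_mod_eq)
  then show "kronecker_mat (1\<^sub>m n) (1\<^sub>m m) $$ (i, j) = (1\<^sub>m (n * m) :: 'a mat) $$ (i, j)"
    using i j div_mod_less_mult[OF i] div_mod_less_mult[OF j]
    by (auto simp: index_kronecker_mat[OF one_carrier_mat one_carrier_mat])
qed (auto simp: kronecker_mat_def)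

section \<open>Kronecker sums and similarity\<close>

definition kronecker_sum :: "'a :: semiring_1 mat \<Rightarrow> 'a mat \<Rightarrow> 'a mat" where
  "kronecker_sum A B =
     kronecker_mat A (1\<^sub>m (dim_row B)) + kronecker_mat (1\<^sub>m (dim_row A)) B"

lemma kronecker_sum_carrier [intro, simp]:
  assumes "A \<in> carrier_mat n n" "B \<in> carrier_mat m m"
  shows "kronecker_sum A B \<in> carrier_mat (n * m) (n * m)"
  using assms by (auto simp: kronecker_sum_def)

lemma index_kronecker_sum:
  assumes A: "A \<in> carrier_mat n n" and B: "B \<in> carrier_mat m m" and i: "i < n * m" and j: "j < n * m"
  shows "kronecker_sum A B $$ (i, j) =
    (if i mod m = j mod m then A $$ (i div m, j div m) else 0) +
    (if i div m = j div m then B $$ (i mod m, j mod m) else 0)"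
  using assms div_mod_less_mult[OF i] div_mod_less_mult[OF j]
  by (simp add: kronecker_sum_def index_kronecker_mat[OF A one_carrier_mat]
      index_kronecker_mat[OF one_carrier_mat B]
      carrier_matD[OF kronecker_mat_carrier[OF one_carrier_mat B]])

text \<open>One conjugating pair serves both summands: by the mixed-product rule
  \<open>B \<otimes> I\<close> becomes \<open>P B Q \<otimes> R S = A \<otimes> I\<close>, and
  \<open>I \<otimes> D\<close> becomes \<open>P Q \<otimes> R D S = I \<otimes> C\<close>.\<close>

lemma similar_mat_wit_kronecker_sum:
  fixes A B C D :: "'a :: comm_ring_1 mat"
  assumes "similar_mat_wit A B P Q" "similar_mat_wit C D R S"
  shows "similar_mat_wit (kronecker_sum A C) (kronecker_sum B D)
    (kronecker_mat P R) (kronecker_mat Q S)"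
proof -
  define n m where "n = dim_row A" and "m = dim_row C"
  note A = similar_mat_witD[OF n_def assms(1)] and C = similar_mat_witD[OF m_def assms(2)]
  note carr = A(4-7) C(4-7)
  show ?thesis
  proof (rule similar_mat_witI)
    show "kronecker_mat P R * kronecker_mat Q S = 1\<^sub>m (n * m)"
      using A C by (simp add: kronecker_mat_mult kronecker_mat_one)
    show "kronecker_mat Q S * kronecker_mat P R = 1\<^sub>m (n * m)"
      using A C by (simp add: kronecker_mat_mult kronecker_mat_one)
    have 1: "kronecker_mat P R * kronecker_mat B (1\<^sub>m m) * kronecker_mat Q S = kronecker_mat A (1\<^sub>m m)"
    proof -
      have "kronecker_mat P R * kronecker_mat B (1\<^sub>m m) = kronecker_mat (P * B) (R * 1\<^sub>m m)"
        using carr by (intro kronecker_mat_mult) auto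
      moreover have "kronecker_mat (P * B) R * kronecker_mat Q S = kronecker_mat (P * B * Q) (R * S)"
        using carr by (intro kronecker_mat_mult) auto
      ultimately show ?thesis using A(3) C(1) carr by simp
    qed
    have 2: "kronecker_mat P R * kronecker_mat (1\<^sub>m n) D * kronecker_mat Q S = kronecker_mat (1\<^sub>m n) C"
    proof -
      have "kronecker_mat P R * kronecker_mat (1\<^sub>m n) D = kronecker_mat (P * 1\<^sub>m n) (R * D)"
        using carr by (intro kronecker_mat_mult) auto
      moreover have "kronecker_mat P (R * D) * kronecker_mat Q S = kronecker_mat (P * Q) (R * D * S)"
        using carr by (intro kronecker_mat_mult) auto
      ultimately show ?thesis using C(3) A(1) carr by simp
    qed
    have kB: "kronecker_mat B (1\<^sub>m m) \<in> carrier_mat (n * m) (n * m)"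
      and kD: "kronecker_mat (1\<^sub>m n) D \<in> carrier_mat (n * m) (n * m)"
      and kP: "kronecker_mat P R \<in> carrier_mat (n * m) (n * m)"
      and kQ: "kronecker_mat Q S \<in> carrier_mat (n * m) (n * m)"
      using carr by auto
    have dims: "dim_row A = n" "dim_row B = n" "dim_row C = m" "dim_row D = m"
      using carr by auto
    have "kronecker_mat P R * kronecker_sum B D * kronecker_mat Q S =
        kronecker_mat P R * kronecker_mat B (1\<^sub>m m) * kronecker_mat Q S +
        kronecker_mat P R * kronecker_mat (1\<^sub>m n) D * kronecker_mat Q S"
      unfolding kronecker_sum_def dims mult_add_distrib_mat[OF kP kB kD]
      by (rule add_mult_distrib_mat[OF mult_carrier_mat[OF kP kB] mult_carrier_mat[OF kP kD] kQ])
    then show "kronecker_sum A C = kronecker_mat P R * kronecker_sum B D * kronecker_mat Q S"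
      by (simp add: 1 2 kronecker_sum_def dims)
  qed (use carr in auto)
qed

section \<open>Diagonalising the Laplacian of the complete graph\<close>

lemma sum_of_bool_eq_mult:
  fixes f :: "nat \<Rightarrow> 'a :: semiring_1"
  shows "(\<Sum>k<n. of_bool (i = k) * f k) = (if i < n then f i else 0)"
    and "(\<Sum>k<n. of_bool (k = i) * f k) = (if i < n then f i else 0)"
    and "(\<Sum>k<n. of_bool (i = k) :: 'a) = of_bool (i < n)"
    and "(\<Sum>k<n. of_bool (k = i) :: 'a) = of_bool (i < n)"
proof -
  have *: "of_bool (i = k) * f k = (if i = k then f k else 0)"
    "of_bool (k = i) * f k = (if k = i then f k else 0)"
    "(of_bool (i = k) :: 'a) = (if i = k then 1 else 0)"
    "(of_bool (k = i) :: 'a) = (if k = i then 1 else 0)" for k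
    by auto
  show "(\<Sum>k<n. of_bool (i = k) * f k) = (if i < n then f i else 0)"
    "(\<Sum>k<n. of_bool (k = i) * f k) = (if i < n then f i else 0)"
    "(\<Sum>k<n. of_bool (i = k) :: 'a) = of_bool (i < n)"
    "(\<Sum>k<n. of_bool (k = i) :: 'a) = of_bool (i < n)"
    unfolding * by (simp_all add: if_distrib[of "\<lambda>x. x * _"] cong: if_cong)
qed

definition complete_laplacian :: "nat \<Rightarrow> real mat" where
  "complete_laplacian l = mat l l (\<lambda>(i, j). (if i = j then real l else 0) - 1)"

definition complete_spectrum :: "nat \<Rightarrow> real mat" where
  "complete_spectrum l = mat l l (\<lambda>(i, j). if i = j \<and> 0 < i then real l else 0)"

text \<open>The inverse basis change sends \<open>v\<close> to its mean followed by \<open>v\<^sub>k - mean\<close> for \<open>k \<ge> 1\<close>, because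
  \<open>v = mean \<cdot> \<one> + (\<Sum>k\<ge>1. (v\<^sub>k - mean) (e\<^sub>k - e\<^sub>0))\<close>.\<close>

definition complete_basis :: "nat \<Rightarrow> real mat" where
  "complete_basis l = mat l l (\<lambda>(i, k). if k = 0 then 1 else of_bool (i = k) - of_bool (i = 0))"

definition complete_basis_inv :: "nat \<Rightarrow> real mat" where
  "complete_basis_inv l =
     mat l l (\<lambda>(k, j). if k = 0 then 1 / real l else of_bool (k = j) - 1 / real l)"

text \<open>The all-ones matrix multiplies the all-ones vector by \<open>l\<close> and annihilates
  each \<open>e_k - e_0\<close>. Hence \<open>l I - J\<close> has eigenvalue 0 on the former and
  \<open>l\<close> on the latter.\<close>

lemma similar_mat_wit_complete_laplacian:
  assumes l: "l > 0"
  shows "similar_mat_wit (complete_laplacian l) (complete_spectrum l)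
    (complete_basis l) (complete_basis_inv l)"
proof -
  obtain m where m: "l = Suc m" using l by (cases l) auto
  have carr: "complete_laplacian l \<in> carrier_mat l l" "complete_spectrum l \<in> carrier_mat l l"
    "complete_basis l \<in> carrier_mat l l" "complete_basis_inv l \<in> carrier_mat l l"
    by (auto simp: complete_laplacian_def complete_spectrum_def complete_basis_def complete_basis_inv_def)
  have PQ: "complete_basis l * complete_basis_inv l = 1\<^sub>m l"
  proof (rule eq_matI)
    fix i j assume "i < dim_row (1\<^sub>m l :: real mat)" "j < dim_col (1\<^sub>m l :: real mat)"
    then have ij: "i < l" "j < l" by auto
    define c where "c = 1 / real l"
    have c: "real m * c = 1 - c" by (simp add: c_def m field_simps)
    have "(complete_basis l * complete_basis_inv l) $$ (i, j) =
      c + (\<Sum>k<m. (of_bool (i = Suc k) - of_bool (i = 0)) * (of_bool (Suc k = j) - c))"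
      using ij by (simp add: complete_basis_def complete_basis_inv_def scalar_prod_def
        atLeast0LessThan c_def m sum.lessThan_Suc_shift del: sum.lessThan_Suc)
    \<comment> \<open>For \<open>i = 0\<close> the sum is \<open>m * c - of_bool (j > 0)\<close>,
      and \<open>m * c = 1 - c\<close> because \<open>l = m + 1\<close>. For \<open>i > 0\<close>
      only \<open>k = i - 1\<close> survives, giving \<open>of_bool (i = j) - c\<close>.\<close>
    also have "\<dots> = of_bool (i = j)"
      using ij by (cases i; cases j)
        (auto simp: m c sum_subtractf sum_negf sum_of_bool_eq_mult)
    finally show "(complete_basis l * complete_basis_inv l) $$ (i, j) = (1\<^sub>m l :: real mat) $$ (i, j)"
      using ij by simp
  qed (use carr in auto)
  then have QP: "complete_basis_inv l * complete_basis l = 1\<^sub>m l"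
    using mat_mult_left_right_inverse carr by blast
  \<comment> \<open>Read column by column, this is the eigenvector equation for each basis
    vector.\<close>
  have "complete_laplacian l * complete_basis l = complete_basis l * complete_spectrum l"
  proof (rule eq_matI)
    fix i j assume "i < dim_row (complete_basis l * complete_spectrum l)"
      "j < dim_col (complete_basis l * complete_spectrum l)"
    then have ij: "i < l" "j < l" using carr by auto
    have "(complete_laplacian l * complete_basis l) $$ (i, j) =
        (\<Sum>s<l. (real l * of_bool (s = i) - 1) *
          (if j = 0 then 1 else of_bool (s = j) - of_bool (s = 0)))"
      using ij by (auto simp: complete_laplacian_def complete_basis_def scalar_prod_def
          atLeast0LessThan intro!: sum.cong)
    also have "\<dots> = (if j = 0 then 0 else real l * (of_bool (i = j) - of_bool (i = 0)))"
      using ij l by (auto simp: left_diff_distrib right_diff_distrib sum_subtractf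
          simp flip: sum_distrib_left)
    \<comment> \<open>The single value is inflated to a sum over \<open>s\<close> supported at
      \<open>s = j\<close>, to match the product with a diagonal matrix.\<close>
    also have "\<dots> = (\<Sum>s<l. of_bool (s = j) * (complete_basis l $$ (i, s) * (if 0 < j then real l else 0)))"
      unfolding sum_of_bool_eq_mult using ij by (simp add: complete_basis_def)
    also have "\<dots> = (\<Sum>s<l. complete_basis l $$ (i, s) * complete_spectrum l $$ (s, j))"
      using ij by (intro sum.cong) (auto simp: complete_spectrum_def)
    also have "\<dots> = (complete_basis l * complete_spectrum l) $$ (i, j)"
      using ij carr by (simp add: scalar_prod_def atLeast0LessThan)
    finally show "(complete_laplacian l * complete_basis l) $$ (i, j) =
      (complete_basis l * complete_spectrum l) $$ (i, j)" .
  qed (use carr in auto)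
  then have "complete_basis l * complete_spectrum l * complete_basis_inv l =
      complete_laplacian l * (complete_basis l * complete_basis_inv l)"
    using assoc_mult_mat[OF carr(1,3,4)] by metis
  then have "complete_laplacian l = complete_basis l * complete_spectrum l * complete_basis_inv l"
    using carr PQ by simp
  then show ?thesis
    using PQ QP carr by (intro similar_mat_witI)
qed

section \<open>The lattice Laplacian as a Kronecker sum\<close>

text \<open>Two distinct vertices lie in a common row, in a common column or in neither, never in
  both, so they share at most one hyperedge. Equal vertices get 0 by definition, like vertices that
  differ in both coordinates.\<close>

lemma clique_adjacency_lattice:
  assumes "a < l" "b < l" "c < l" "d < l"
  shows "clique_adjacency (lattice_hyperedges l) (a, b) (c, d) =
    (if (a = c) = (b = d) then 0 else 1)"
proof (cases "(a, b) = (c, d)")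
  case False
  have "{e \<in> lattice_hyperedges l. (a, b) \<in> e \<and> (c, d) \<in> e} =
    (if a = c then {lattice_row l a} else {}) \<union> (if b = d then {lattice_column l b} else {})"
    using assms by (auto simp: lattice_hyperedges_def lattice_row_def lattice_column_def)
  then show ?thesis using False by (auto simp: clique_adjacency_def)
qed (auto simp: clique_adjacency_def)

lemma lattice_clique_laplacian_eq:
  "lattice_clique_laplacian l = kronecker_sum (complete_laplacian l) (complete_laplacian l)"
proof (rule eq_matI)
  have K: "complete_laplacian l \<in> carrier_mat l l" by (simp add: complete_laplacian_def)
  note KK = kronecker_sum_carrier[OF K K]
  show "dim_row (lattice_clique_laplacian l) =
      dim_row (kronecker_sum (complete_laplacian l) (complete_laplacian l))"
    "dim_col (lattice_clique_laplacian l) =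
      dim_col (kronecker_sum (complete_laplacian l) (complete_laplacian l))"
    using KK by (auto simp: lattice_clique_laplacian_def clique_laplacian_mat_def row_sum_mat_def
        clique_adjacency_mat_def power2_eq_square)
  fix i j
  assume "i < dim_row (kronecker_sum (complete_laplacian l) (complete_laplacian l))"
    "j < dim_col (kronecker_sum (complete_laplacian l) (complete_laplacian l))"
  then have i: "i < l * l" and j: "j < l * l" using KK by auto
  note b = div_mod_less_mult[OF i] div_mod_less_mult[OF j]
  let ?A = "clique_adjacency_mat (lattice_hyperedges l) (l\<^sup>2) (lattice_vertex l)"
  \<comment> \<open>The exclusive or of two conditions is written as
    \<open>p + q - 2 * p * q\<close> in their indicators, which makes the row sum separate over the
    two coordinates.\<close>
  have A: "?A $$ (i, k) = of_bool (i div l = k div l) + of_bool (i mod l = k mod l)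
      - 2 * (of_bool (i div l = k div l) * of_bool (i mod l = k mod l))" if "k < l * l" for k
    using i b that div_mod_less_mult[OF that]
    by (simp add: clique_adjacency_mat_def lattice_vertex_def power2_eq_square clique_adjacency_lattice)
  have "(\<Sum>k<l * l. ?A $$ (i, k)) = (\<Sum>k<l * l. of_bool (i div l = k div l) + of_bool (i mod l = k mod l)
      - 2 * (of_bool (i div l = k div l) * of_bool (i mod l = k mod l)))"
    by (intro sum.cong refl A) simp
  also have "\<dots> = (\<Sum>a<l. \<Sum>c<l. of_bool (i div l = a) + of_bool (i mod l = c)
      - 2 * (of_bool (i div l = a) * of_bool (i mod l = c)))"
    by (rule sum_lessThan_mult_div_mod)
  \<comment> \<open>Each single indicator is 1 for \<open>l\<close> of the pairs, their product for
    exactly one.\<close>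
  also have "\<dots> = 2 * real l - 2"
    using b by (simp add: sum.distrib sum_subtractf sum_of_bool_eq_mult flip: sum_distrib_left)
  finally have S: "(\<Sum>k<l * l. ?A $$ (i, k)) = 2 * real l - 2" .
  have "i = j \<longleftrightarrow> i div l = j div l \<and> i mod l = j mod l"
    by (metis div_mult_mod_eq)
  moreover have "lattice_clique_laplacian l $$ (i, j) =
      (if i = j then 2 * real l - 2 else 0) - ?A $$ (i, j)"
    using i j by (simp add: lattice_clique_laplacian_def clique_laplacian_mat_def row_sum_mat_def
      clique_adjacency_mat_def power2_eq_square flip: S)
  ultimately show "lattice_clique_laplacian l $$ (i, j) =
      kronecker_sum (complete_laplacian l) (complete_laplacian l) $$ (i, j)"
    using b unfolding index_kronecker_sum[OF K K i j]
    by (auto simp: A[OF j] complete_laplacian_def)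
qed

section \<open>Characteristic polynomial and multiplicities\<close>

text \<open>The order of a root is additive over a nonzero product, and a monic linear factor has
  order 1 at its root and 0 elsewhere.\<close>

lemma order_prod_linear:
  fixes d :: "nat \<Rightarrow> 'a :: idom"
  shows "order x (\<Prod>i<n. [:- d i, 1:]) = (\<Sum>i<n. of_bool (d i = x))"
proof (induction n)
  case (Suc n)
  have "(\<Prod>i<Suc n. [:- d i, 1:]) \<noteq> 0" by (simp del: prod.lessThan_Suc)
  then have "order x (\<Prod>i<Suc n. [:- d i, 1:]) = order x (\<Prod>i<n. [:- d i, 1:]) + order x [:- d n, 1:]"
    unfolding prod.lessThan_Suc by (rule order_mult)
  moreover have "order x [:- d n, 1:] = of_bool (d n = x)"
    using order_power_n_n[of x 1] by (auto intro!: order_0I)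
  ultimately show ?case by (simp add: Suc)
qed (simp add: order_0I)

lemma order_char_poly_lattice_clique_laplacian:
  assumes "l > 0"
  shows "order x (char_poly (lattice_clique_laplacian l)) =
    (\<Sum>i<l. \<Sum>j<l. of_bool ((if 0 < i then real l else 0) + (if 0 < j then real l else 0) = x))"
proof -
  let ?D = "kronecker_sum (complete_spectrum l) (complete_spectrum l)"
  let ?f = "\<lambda>i j. (if 0 < i then real l else 0) + (if 0 < j then real l else 0)"
  have K: "complete_spectrum l \<in> carrier_mat l l" by (simp add: complete_spectrum_def)
  note D = kronecker_sum_carrier[OF K K]
  have "similar_mat (lattice_clique_laplacian l) ?D"
    unfolding lattice_clique_laplacian_eq similar_mat_def
    using similar_mat_wit_kronecker_sum similar_mat_wit_complete_laplacian[OF assms] by blast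
  then have "char_poly (lattice_clique_laplacian l) = char_poly ?D"
    by (rule char_poly_similar)
  also have "\<dots> = (\<Prod>a\<leftarrow>diag_mat ?D. [:- a, 1:])"
  proof (rule char_poly_upper_triangular[OF D])
    show "upper_triangular ?D"
    proof (rule upper_triangularI)
      fix i j assume "j < i" "i < dim_row ?D"
      then have i: "i < l * l" and j: "j < l * l" and "i \<noteq> j" using D by auto
      then have "\<not> (i div l = j div l \<and> i mod l = j mod l)"
        by (metis div_mult_mod_eq)
      \<comment> \<open>If one coordinate agrees, the other differs, so the only entry of the
        spectrum matrix that could contribute is off its diagonal.\<close>
      then show "?D $$ (i, j) = 0"
        using div_mod_less_mult[OF i] div_mod_less_mult[OF j]
        unfolding index_kronecker_sum[OF K K i j] by (auto simp: complete_spectrum_def)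
    qed
  qed
  also have "\<dots> = (\<Prod>i<l * l. [:- ?D $$ (i, i), 1:])"
    using D by (simp add: diag_mat_def o_def prod.distinct_set_conv_list[symmetric] atLeast0LessThan)
  also have "order x \<dots> = (\<Sum>i<l * l. of_bool (?D $$ (i, i) = x))"
    by (rule order_prod_linear)
  also have "\<dots> = (\<Sum>k<l * l. of_bool (?f (k div l) (k mod l) = x))"
  proof (intro sum.cong refl)
    fix i assume "i \<in> {..<l * l}"
    then have i: "i < l * l" by simp
    show "of_bool (?D $$ (i, i) = x) = (of_bool (?f (i div l) (i mod l) = x) :: nat)"
      using div_mod_less_mult[OF i]
      unfolding index_kronecker_sum[OF K K i i] by (simp add: complete_spectrum_def)
  qed
  also have "\<dots> = (\<Sum>i<l. \<Sum>j<l. of_bool (?f i j = x))"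
    by (rule sum_lessThan_mult_div_mod)
  finally show ?thesis .
qed

theorem proposition2:
  fixes l :: nat
  assumes "l \<ge> 2"
  shows "{k. eigenvalue (lattice_clique_laplacian l) k} = {0, real l, 2 * real l} \<and>
    eigenvalue_multiplicity (lattice_clique_laplacian l) 0 = 1 \<and>
    eigenvalue_multiplicity (lattice_clique_laplacian l) (real l) = 2 * (l - 1) \<and>
    eigenvalue_multiplicity (lattice_clique_laplacian l) (2 * real l) = (l - 1)\<^sup>2"
proof -
  let ?L = "lattice_clique_laplacian l"
  obtain m where m: "l = Suc m" "m > 0" using assms by (cases l) auto
  have ord: "order x (char_poly ?L) =
      of_bool (x = 0) + 2 * m * of_bool (x = real l) + m * m * of_bool (x = 2 * real l)" for x
  proof -
    \<comment> \<open>Index 0 is split off both sums: the pair \<open>(0, 0)\<close> yields 0, the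
      \<open>m\<close> pairs on either axis yield \<open>l\<close>, and the remaining
      \<open>m * m\<close> pairs yield \<open>2 * l\<close>.\<close>
    have "order x (char_poly ?L) = of_bool (0 = x) + m * of_bool (real l = x)
        + m * (of_bool (real l = x) + m * of_bool (2 * real l = x))"
      using order_char_poly_lattice_clique_laplacian[of l x] m(1)
      by (simp add: sum.lessThan_Suc_shift del: sum.lessThan_Suc)
    then show ?thesis by (auto simp: algebra_simps)
  qed
  have L: "?L \<in> carrier_mat (l\<^sup>2) (l\<^sup>2)"
    unfolding lattice_clique_laplacian_def clique_laplacian_mat_def clique_adjacency_mat_def
    by (intro minus_carrier_mat mat_carrier)
  \<comment> \<open>Being monic excludes the zero polynomial, so a root is the same as a point of
    nonzero order.\<close>
  then have "char_poly ?L \<noteq> 0"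
    using degree_monic_char_poly[OF L] by auto
  then have "eigenvalue ?L k \<longleftrightarrow> order k (char_poly ?L) \<noteq> 0" for k
    by (simp add: eigenvalue_root_char_poly[OF L] order_root)
  \<comment> \<open>Since \<open>m > 0\<close>, the multiplicities of \<open>l\<close> and
    \<open>2 * l\<close> are positive, so both values occur.\<close>
  then have "{k. eigenvalue ?L k} = {0, real l, 2 * real l}"
    using m(2) assms by (auto simp: ord)
  moreover have "m = l - 1"
    using m(1) by simp
  ultimately show ?thesis
    using assms by (simp add: eigenvalue_multiplicity_def ord power2_eq_square)
qed

end
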